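(* Let $n\ge 1$ and let $t,a,b,c,d$ be complex parameters of modulus less than $1$. Then $$\int_{T} \Delta_{K}^{(n)}(z;t;a,b,c,d)\, dT = \prod_{i=0}^{n-1} \frac{1}{(1-t^{i}ac)(1-t^{i}bc)(1-t^{i}cd)(1-t^{i}ad)(1-t^{i}bd)} \prod_{j=n-1}^{2n-2} (1-t^{j}abcd).$$
   Context: $T=T_n=\{(z_1,\dots,z_n):|z_1|=\dots=|z_n|=1\}$ and $dT=\prod_{j=1}^n\frac{dz_j}{2\pi\sqrt{-1}\,z_j}$. The $q=0$ nonsymmetric Koornwinder density is $$\Delta_{K}^{(n)}(z;t;a,b,c,d)=\prod_{1 \leq i \leq n} \frac{(1-z_{i}^{2})}{(1-az_{i})(1-bz_{i})(1-cz_{i})(1-dz_{i})(1-cz_{i}^{-1})(1-dz_{i}^{-1})} \prod_{1 \leq i<j \leq n} \frac{1-z_{i}z_{j}^{\pm 1}}{1-tz_{i}z_{j}^{\pm 1}},$$ where $1-z_iz_j^{\pm1}$ stands for $(1-z_iz_j)(1-z_iz_j^{-1})$ and $1-tz_iz_j^{\pm1}$ for $(1-tz_iz_j)(1-tz_iz_j^{-1})$. *)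

theory Defs
  imports "HOL-Complex_Analysis.Complex_Analysis"
begin

(* The measure dz / (2 pi i z) on the unit circle: with z = exp(i theta) it is
   d theta / (2 pi) for theta in [0, 2 pi].  Lemma integral_circle_measure below
   relates it to the contour integral along the positively oriented unit circle. *)
definition circle_measure :: "complex measure" where
  "circle_measure =
     distr (uniform_measure lborel {0..2 * pi}) (restrict_space borel (sphere 0 1)) cis"

(* The product measure dT on T_n.  Points of T_n are functions on the index set {1..n}
   (undefined elsewhere); see space_torus_measure. *)
definition torus_measure :: "nat \<Rightarrow> (nat \<Rightarrow> complex) measure" where
  "torus_measure n = (\<Pi>\<^sub>M j\<in>{1..n}. circle_measure)"

definition koornwinder_density ::
  "nat \<Rightarrow> (nat \<Rightarrow> complex) \<Rightarrow> complex \<Rightarrow> complex \<Rightarrow> complex \<Rightarrow> complex \<Rightarrow> complex \<Rightarrow> complex" where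
  "koornwinder_density n z t a b c d =
     (\<Prod>i\<in>{1..n}. (1 - (z i)\<^sup>2) /
        ((1 - a * z i) * (1 - b * z i) * (1 - c * z i) * (1 - d * z i) *
         (1 - c * inverse (z i)) * (1 - d * inverse (z i)))) *
     (\<Prod>i\<in>{1..n}. \<Prod>j\<in>{i<..n}.
        ((1 - z i * z j) * (1 - z i * inverse (z j))) /
        ((1 - t * z i * z j) * (1 - t * z i * inverse (z j))))"

lemma space_circle_measure: "space circle_measure = sphere 0 1"
  by (simp add: circle_measure_def space_restrict_space)

lemma space_torus_measure: "space (torus_measure n) = (\<Pi>\<^sub>E j\<in>{1..n}. sphere 0 1)"
  by (simp add: torus_measure_def space_PiM space_circle_measure)

lemma measurable_cis_circle:
  "cis \<in> uniform_measure lborel {0..2 * pi} \<rightarrow>\<^sub>M restrict_space borel (sphere 0 1)"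
proof -
  have "continuous_on UNIV cis" by (intro continuous_intros)
  then have "cis \<in> borel \<rightarrow>\<^sub>M borel" by (rule borel_measurable_continuous_onI)
  then have "cis \<in> uniform_measure lborel {0..2 * pi} \<rightarrow>\<^sub>M borel" by simp
  then show ?thesis by (intro measurable_restrict_space2) auto
qed

lemma integral_circle_measure:
  assumes f: "continuous_on (sphere 0 1) f"
  shows "(\<integral>z. f z \<partial>circle_measure) =
         contour_integral (circlepath 0 1) (\<lambda>z. f z / (2 * of_real pi * \<i> * z))"
proof -
  have fm: "f \<in> borel_measurable (restrict_space borel (sphere 0 1))"
    using f by (rule borel_measurable_continuous_on_restrict)
  have cont: "continuous_on {0..2 * pi} (\<lambda>x. f (cis x))"
    by (rule continuous_on_compose2[OF f]) (auto intro!: continuous_intros)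
  have int: "set_integrable lborel {0..2 * pi} (\<lambda>x. f (cis x))"
    using cont by (rule borel_integrable_atLeastAtMost')
  have fcm: "(\<lambda>x. f (cis x)) \<in> borel_measurable borel"
    using measurable_compose[OF measurable_cis_circle fm] by simp
  have "(\<integral>z. f z \<partial>circle_measure) = (\<integral>x. f (cis x) \<partial>uniform_measure lborel {0..2 * pi})"
    unfolding circle_measure_def
    by (rule integral_distr[OF measurable_cis_circle fm])
  also have "uniform_measure lborel {0..2 * pi} =
      density lborel (\<lambda>x. ennreal (indicator {0..2 * pi} x / (2 * pi)))"
    unfolding uniform_measure_def
    by (intro density_cong) (auto simp: indicator_def divide_ennreal[symmetric] split: if_splits)
  also have "(\<integral>x. f (cis x) \<partial>\<dots>) =
      (\<integral>x. (indicator {0..2 * pi} x / (2 * pi)) *\<^sub>R f (cis x) \<partial>lborel)"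
    using fcm by (intro integral_density) auto
  also have "\<dots> = (1 / (2 * pi)) *\<^sub>R (LINT x:{0..2 * pi}|lborel. f (cis x))"
    unfolding set_lebesgue_integral_def
    by (subst integral_scaleR_right[symmetric]) (simp_all add: mult.commute)
  also have "(LINT x:{0..2 * pi}|lborel. f (cis x)) = integral {0..2 * pi} (\<lambda>x. f (cis x))"
    using int by (rule set_borel_integral_eq_integral(2))
  also have "(1 / (2 * pi)) *\<^sub>R \<dots> =
      integral {0..2 * pi} (\<lambda>x. f (cis x) / (2 * of_real pi * \<i> * cis x) * (\<i> * cis x))"
    by (simp add: scaleR_conv_of_real field_simps flip: integral_mult_right)
  also have "\<dots> = contour_integral (circlepath 0 1) (\<lambda>z. f z / (2 * of_real pi * \<i> * z))"
  proof -
    have "continuous_on {0..2 * pi}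
        (\<lambda>x. f (cis x) / (2 * of_real pi * \<i> * cis x) * (\<i> * cis x))"
      using cont by (intro continuous_intros) auto
    from integrable_integral[OF integrable_continuous_real[OF this]] show ?thesis
      unfolding circlepath_def
      by (intro contour_integral_unique[symmetric])
        (subst has_contour_integral_part_circlepath_iff, simp_all add: mult.assoc)
  qed
  finally show ?thesis .
qed

end

theory Submission
  imports Defs "HOL-Probability.Probability"
begin

text \<open>
  Integrate over the first variable \<open>z\<^sub>1\<close> only, the other variables being fixed on the unit circle.
  Since every parameter has modulus less than 1, the denominators \<open>1 - a z\<^sub>1\<close>, \<open>1 - b z\<^sub>1\<close>,
  \<open>1 - c z\<^sub>1\<close>, \<open>1 - d z\<^sub>1\<close> and all the \<open>1 - t z\<^sub>1 z\<^sub>j\<close>, \<open>1 - t z\<^sub>1 / z\<^sub>j\<close> vanish only outside the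
  closed disc: the density is nonsymmetric in such a way that \<open>z\<^sub>1\<close> never appears inverted together
  with another variable. The poles inside the disc come from
  \<open>1 / (z\<^sub>1 (1 - c / z\<^sub>1) (1 - d / z\<^sub>1)) = z\<^sub>1 / ((z\<^sub>1 - c) (z\<^sub>1 - d))\<close>, so for \<open>c \<noteq> d\<close> there
  are just two residues (\<open>circle_integral_first_variable\<close>).

  At \<open>z\<^sub>1 = c\<close> the pair factor of \<open>z\<^sub>1\<close> and \<open>z\<^sub>j\<close> becomes
  \<open>(1 - c z\<^sub>j) (1 - c / z\<^sub>j) / ((1 - t c z\<^sub>j) (1 - t c / z\<^sub>j))\<close>, which is exactly what turns the
  parameter \<open>c\<close> of the remaining density into \<open>t c\<close>
  (\<open>cross_factor_mult_koornwinder_factor\<close>). Writing \<open>J\<^sub>n(c, d)\<close> for the integral, this gives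
  (\<open>integral_koornwinder_density_on_insert_min\<close>)
  \<open>(c - d) J\<^sub>n(c, d) = c J\<^sub>n\<^sub>-\<^sub>1(t c, d) / ((1 - a c) (1 - b c) (1 - c d))
    - d J\<^sub>n\<^sub>-\<^sub>1(c, t d) / ((1 - a d) (1 - b d) (1 - c d))\<close>.

  The claimed product obeys the same recurrence (\<open>koornwinder_value_recurrence\<close>): after division by
  common factors it is the identity, with \<open>T = t\<^sup>n\<^sup>-\<^sup>1\<close>,
  \<open>c (1 - T a d) (1 - T b d) - d (1 - T a c) (1 - T b c) = (c - d) (1 - T\<^sup>2 a b c d)\<close>.
  Induction on the number of variables then proves the evaluation for \<open>c \<noteq> d\<close>. When \<open>c = d\<close> the two
  poles collide; both sides are continuous in \<open>d\<close>, the integral by dominated convergence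
  (\<open>tendsto_integral_koornwinder_density_on\<close>), and the evaluation extends. The induction has to
  range over all \<open>c\<close> and \<open>d\<close> at once, because the recurrence changes them and may make them equal.
\<close>

section \<open>The density on a finite set of variables\<close>

definition koornwinder_factor :: "complex \<Rightarrow> complex \<Rightarrow> complex \<Rightarrow> complex \<Rightarrow> complex \<Rightarrow> complex" where
  "koornwinder_factor a b c d z = (1 - z\<^sup>2) /
     ((1 - a * z) * (1 - b * z) * (1 - c * z) * (1 - d * z) *
      (1 - c * inverse z) * (1 - d * inverse z))"

definition cross_factor :: "complex \<Rightarrow> complex \<Rightarrow> complex \<Rightarrow> complex" where
  "cross_factor t z w = ((1 - z * w) * (1 - z * inverse w)) /
     ((1 - t * z * w) * (1 - t * z * inverse w))"

text \<open>
  Removing \<open>z\<^sub>1\<close> leaves the variables \<open>z\<^sub>2, \<dots>, z\<^sub>n\<close>. Allowing any index set makes the remaining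
  density an instance of the same function, so that no variables have to be renumbered.
\<close>

definition koornwinder_density_on ::
  "nat set \<Rightarrow> (nat \<Rightarrow> complex) \<Rightarrow> complex \<Rightarrow> complex \<Rightarrow> complex \<Rightarrow> complex \<Rightarrow> complex \<Rightarrow> complex" where
  "koornwinder_density_on I z t a b c d =
     (\<Prod>i\<in>I. koornwinder_factor a b c d (z i)) *
     (\<Prod>i\<in>I. \<Prod>j\<in>{j\<in>I. i < j}. cross_factor t (z i) (z j))"

lemma koornwinder_density_eq_on:
  "koornwinder_density n z t a b c d = koornwinder_density_on {1..n} z t a b c d"
proof -
  have "{j \<in> {1..n}. i < j} = {i<..n}" if "i \<in> {1..n}" for i
    using that by auto
  then have "(\<Prod>i\<in>{1..n}. \<Prod>j\<in>{i<..n}. cross_factor t (z i) (z j)) =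
    (\<Prod>i\<in>{1..n}. \<Prod>j\<in>{j\<in>{1..n}. i < j}. cross_factor t (z i) (z j))"
    by (intro prod.cong) auto
  then show ?thesis
    unfolding koornwinder_density_def koornwinder_density_on_def
      koornwinder_factor_def cross_factor_def by (rule arg_cong)
qed

text \<open>The least index is the one that occurs only as the first entry of a pair.\<close>

lemma koornwinder_density_on_insert_min:
  assumes "finite I" and less: "\<And>j. j \<in> I \<Longrightarrow> m < j"
  shows "koornwinder_density_on (insert m I) z t a b c d =
    koornwinder_factor a b c d (z m) * (\<Prod>j\<in>I. cross_factor t (z m) (z j)) *
    koornwinder_density_on I z t a b c d"
proof -
  have m: "m \<notin> I" using less by blast
  have "{j \<in> insert m I. m < j} = I"
    using less by auto
  moreover have "{j \<in> insert m I. i < j} = {j \<in> I. i < j}" if "i \<in> I" for i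
    using less[OF that] by auto
  ultimately show ?thesis
    using assms(1) m by (simp add: koornwinder_density_on_def cong: prod.cong)
qed

lemma koornwinder_factor_commute:
  "koornwinder_factor a b c d z = koornwinder_factor a b d c z"
  by (simp add: koornwinder_factor_def mult_ac)

lemma koornwinder_density_on_commute:
  "koornwinder_density_on I z t a b c d = koornwinder_density_on I z t a b d c"
  unfolding koornwinder_density_on_def by (subst koornwinder_factor_commute) (rule refl)

section \<open>Factors with parameters in the unit disc\<close>

lemma one_minus_nonzero: "1 - p \<noteq> 0" if "norm p < 1" for p :: complex
  using that by auto

lemma norm_mult_less_one: "norm (p * q) < 1" if "norm p < 1" "norm q \<le> 1" for p q :: complex
proof -
  have "norm p * norm q \<le> norm p * 1"
    using that by (intro mult_left_mono) auto
  then show ?thesis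
    using that by (simp add: norm_mult)
qed

lemma norm_power_mult_less_one: "norm (t ^ k * p) < 1" if "norm t < 1" "norm p < 1"
  for t p :: complex
  using norm_mult_less_one[of p "t ^ k"] that
  by (simp add: norm_power power_le_one mult.commute)

text \<open>
  This cancellation closes the recursion: the residue at \<open>z\<^sub>1 = c\<close> contributes to each remaining
  variable a factor whose numerator removes the two denominators with \<open>c\<close> and whose denominator
  puts back the same two with \<open>t * c\<close>.
\<close>

lemma cross_factor_mult_koornwinder_factor:
  assumes "norm c < 1" "norm z = 1"
  shows "cross_factor t c z * koornwinder_factor a b c d z = koornwinder_factor a b (t * c) d z"
proof -
  have "norm (c * z) < 1" "norm (c * inverse z) < 1"
    using assms by (simp_all add: norm_mult norm_inverse)
  then have "1 - c * z \<noteq> 0" "1 - c * inverse z \<noteq> 0"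
    by (simp_all add: one_minus_nonzero del: right_minus_eq)
  then show ?thesis
    unfolding koornwinder_factor_def cross_factor_def by (simp del: right_minus_eq)
qed

lemma prod_cross_factor_mult_density:
  assumes "norm c < 1" "\<And>j. j \<in> I \<Longrightarrow> norm (z j) = 1"
  shows "(\<Prod>j\<in>I. cross_factor t c (z j)) * koornwinder_density_on I z t a b c d =
    koornwinder_density_on I z t a b (t * c) d"
proof -
  have "(\<Prod>j\<in>I. cross_factor t c (z j)) * (\<Prod>j\<in>I. koornwinder_factor a b c d (z j)) =
    (\<Prod>j\<in>I. koornwinder_factor a b (t * c) d (z j))"
    unfolding prod.distrib[symmetric]
    using assms by (intro prod.cong refl cross_factor_mult_koornwinder_factor) auto
  then show ?thesis
    by (simp add: koornwinder_density_on_def mult.assoc[symmetric])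
qed

section \<open>Integration over the first variable\<close>

text \<open>
  In terms of \<open>dz\<close> the integrand is \<open>f z * z / ((z - c) * (z - d))\<close>, up to \<open>2 * pi * \<i>\<close>, because the
  factor \<open>1 / z\<close> of the measure leaves one of the two powers of \<open>z\<close> that clear the inner
  denominators. Its partial fractions are \<open>c / (z - c)\<close> and \<open>- d / (z - d)\<close>, divided by \<open>c - d\<close>;
  Cauchy's integral formula applies to each.
\<close>

lemma circle_integral_two_poles:
  assumes cont: "continuous_on (cball 0 1) f" and hol: "f holomorphic_on ball 0 1"
    and c: "norm c < 1" and d: "norm d < 1" and "c \<noteq> d"
  shows "(\<integral>z. f z / ((1 - c * inverse z) * (1 - d * inverse z)) \<partial>circle_measure) =
    (c * f c - d * f d) / (c - d)"
proof -
  have nz: "z \<noteq> 0" "z - c \<noteq> 0" "z - d \<noteq> 0" if "norm z = 1" for z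
    using that c d by auto
  have cf: "((\<lambda>z. f z / (z - w)) has_contour_integral (2 * of_real pi * \<i> * f w)) (circlepath 0 1)"
    if "norm w < 1" for w
    using Cauchy_integral_circlepath[OF cont hol, of w] that by simp
  have "((\<lambda>z. (c * (f z / (z - c)) - d * (f z / (z - d))) / ((c - d) * (2 * of_real pi * \<i>)))
      has_contour_integral
      (c * (2 * of_real pi * \<i> * f c) - d * (2 * of_real pi * \<i> * f d)) /
      ((c - d) * (2 * of_real pi * \<i>))) (circlepath 0 1)"
    by (intro has_contour_integral_div has_contour_integral_diff
        has_contour_integral_lmul cf c d)
  also have "(c * (2 * of_real pi * \<i> * f c) - d * (2 * of_real pi * \<i> * f d)) /
      ((c - d) * (2 * of_real pi * \<i>)) = (c * f c - d * f d) / (c - d)"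
    using \<open>c \<noteq> d\<close> by (simp add: field_simps)
  finally have "((\<lambda>z. f z / ((1 - c * inverse z) * (1 - d * inverse z)) /
       (2 * of_real pi * \<i> * z)) has_contour_integral (c * f c - d * f d) / (c - d)) (circlepath 0 1)"
  proof (rule has_contour_integral_eq)
    fix z :: complex
    assume "z \<in> path_image (circlepath 0 1)"
    then have z: "norm z = 1" by simp
    \<comment> \<open>With \<open>z - c\<close> and \<open>z - d\<close> as opaque letters the fractions cancel without being expanded.\<close>
    have ratio: "F * (e * z / (p * q)) / (e * K) = F / (p / z * (q / z)) / (K * z)"
      if "e \<noteq> 0" "K \<noteq> 0" for F e p q K :: complex
      using that nz(1)[OF z] by simp
    have "c / (z - c) - d / (z - d) = (c - d) * z / ((z - c) * (z - d))"
      using nz[OF z] by (subst diff_frac_eq) (auto simp: algebra_simps)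
    moreover have "c * (f z / (z - c)) - d * (f z / (z - d)) = f z * (c / (z - c) - d / (z - d))"
      by (simp add: right_diff_distrib mult.commute)
    moreover have "1 - c * inverse z = (z - c) / z" "1 - d * inverse z = (z - d) / z"
      using nz(1)[OF z] by (simp_all add: field_simps)
    ultimately show "(c * (f z / (z - c)) - d * (f z / (z - d))) / ((c - d) * (2 * of_real pi * \<i>)) =
       f z / ((1 - c * inverse z) * (1 - d * inverse z)) / (2 * of_real pi * \<i> * z)"
      using ratio[of "c - d" "2 * of_real pi * \<i>" "f z" "z - c" "z - d"] \<open>c \<noteq> d\<close> by simp
  qed
  moreover have "continuous_on (sphere 0 1) (\<lambda>z. f z / ((1 - c * inverse z) * (1 - d * inverse z)))"
  proof (intro continuous_intros)
    show "continuous_on (sphere 0 1) f"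
      using cont by (rule continuous_on_subset) auto
    have "1 - p * inverse z \<noteq> 0" if "norm p < 1" "norm z = 1" for p z :: complex
      using that by (intro one_minus_nonzero norm_mult_less_one) (auto simp: norm_inverse)
    then show "\<forall>z\<in>sphere 0 1. (1 - c * inverse z) * (1 - d * inverse z) \<noteq> 0"
      using c d by (auto simp del: right_minus_eq)
  qed (use nz in auto)
  ultimately show ?thesis
    by (simp add: integral_circle_measure contour_integral_unique)
qed

text \<open>
  The numerator \<open>1 - y\<^sup>2\<close>, at \<open>y = c\<close>, cancels the denominator \<open>1 - c * y\<close>, and similarly for \<open>d\<close>; this is why
  the residues carry no factor \<open>1 - c\<^sup>2\<close> or \<open>1 - d\<^sup>2\<close>.
\<close>

lemma circle_integral_first_variable:
  assumes t: "norm t < 1" and a: "norm a < 1" and b: "norm b < 1"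
    and c: "norm c < 1" and d: "norm d < 1" and "c \<noteq> d"
    and x: "\<And>j. j \<in> I \<Longrightarrow> norm (x j) = 1"
  shows "(\<integral>y. koornwinder_factor a b c d y * (\<Prod>j\<in>I. cross_factor t y (x j)) \<partial>circle_measure) =
    (c / ((1 - a * c) * (1 - b * c) * (1 - c * d)) * (\<Prod>j\<in>I. cross_factor t c (x j)) -
     d / ((1 - a * d) * (1 - b * d) * (1 - c * d)) * (\<Prod>j\<in>I. cross_factor t d (x j))) / (c - d)"
proof -
  define f where "f y = (1 - y\<^sup>2) / ((1 - a * y) * (1 - b * y) * (1 - c * y) * (1 - d * y)) *
    (\<Prod>j\<in>I. cross_factor t y (x j))" for y
  have nz: "1 - p * y \<noteq> 0" if "norm p < 1" "y \<in> cball 0 1" for p y :: complex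
    using that by (intro one_minus_nonzero norm_mult_less_one) auto
  have nzx: "1 - t * y * x j \<noteq> 0" "1 - t * y * inverse (x j) \<noteq> 0"
    if "j \<in> I" "y \<in> cball 0 1" for j y
    using that x t by (intro one_minus_nonzero norm_mult_less_one; auto simp: norm_inverse)+
  have "f holomorphic_on ball 0 1"
    unfolding f_def cross_factor_def
    using nz a b c d nzx by (intro holomorphic_intros) auto
  moreover have "continuous_on (cball 0 1) f"
    unfolding f_def cross_factor_def
    using nz[OF a] nz[OF b] nz[OF c] nz[OF d] nzx by (intro continuous_intros) auto
  ultimately have "(\<integral>z. f z / ((1 - c * inverse z) * (1 - d * inverse z)) \<partial>circle_measure) =
    (c * f c - d * f d) / (c - d)"
    using c d \<open>c \<noteq> d\<close> by (intro circle_integral_two_poles)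
  moreover have "f y / ((1 - c * inverse y) * (1 - d * inverse y)) =
      koornwinder_factor a b c d y * (\<Prod>j\<in>I. cross_factor t y (x j))" for y
    by (simp add: f_def koornwinder_factor_def)
  moreover have "f c = 1 / ((1 - a * c) * (1 - b * c) * (1 - c * d)) * (\<Prod>j\<in>I. cross_factor t c (x j))"
    using nz[OF c, of c] c by (simp add: f_def power2_eq_square mult.commute[of d c] del: right_minus_eq)
  moreover have "f d = 1 / ((1 - a * d) * (1 - b * d) * (1 - c * d)) * (\<Prod>j\<in>I. cross_factor t d (x j))"
    using nz[OF d, of d] d by (simp add: f_def power2_eq_square del: right_minus_eq)
  ultimately show ?thesis
    by simp
qed

section \<open>Boundedness and continuity in a parameter\<close>

lemma prob_space_circle_measure: "prob_space circle_measure"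
  unfolding circle_measure_def
  by (intro prob_space.prob_space_distr prob_space_uniform_measure measurable_cis_circle) auto

interpretation circle: prob_space circle_measure
  by (rule prob_space_circle_measure)

interpretation torus: product_sigma_finite "\<lambda>_::nat. circle_measure"
  by unfold_locales

lemma norm_torus_component:
  assumes "z \<in> space (Pi\<^sub>M I (\<lambda>_. circle_measure))" "i \<in> I"
  shows "norm (z i) = 1"
  using PiE_mem[of z I "\<lambda>_. sphere 0 1" i] assms by (simp add: space_PiM space_circle_measure)

lemma measurable_torus_component:
  assumes "i \<in> I"
  shows "(\<lambda>z. z i) \<in> borel_measurable (Pi\<^sub>M I (\<lambda>_. circle_measure))"
proof -
  have "sets circle_measure = sets (restrict_space borel (sphere 0 1))"
    by (simp add: circle_measure_def)
  then have "(\<lambda>w. w) \<in> borel_measurable circle_measure"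
    by (subst measurable_cong_sets[OF _ refl]) (auto intro: measurable_restrict_space1)
  then show ?thesis
    by (rule measurable_compose[OF measurable_component_singleton[OF assms]])
qed

lemma borel_measurable_koornwinder_density_on:
  "(\<lambda>z. koornwinder_density_on I z t a b c d) \<in> borel_measurable (Pi\<^sub>M I (\<lambda>_. circle_measure))"
  unfolding koornwinder_density_on_def koornwinder_factor_def cross_factor_def
  by (intro borel_measurable_times borel_measurable_prod borel_measurable_divide
      borel_measurable_diff borel_measurable_const borel_measurable_power
      borel_measurable_inverse measurable_torus_component) auto

lemma norm_inverse_one_minus_le:
  fixes p :: complex
  assumes "norm p \<le> r" "r < 1"
  shows "norm (inverse (1 - p)) \<le> 1 / (1 - r)"
proof -
  have "1 - r \<le> norm (1 - p)"
    using norm_triangle_ineq2[of 1 p] assms by simp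
  then show ?thesis
    using le_imp_inverse_le[of "1 - r" "norm (1 - p)"] assms by (simp add: norm_inverse divide_inverse)
qed

text \<open>
  The exponent 6 counts the linear denominators, each of modulus at least \<open>1 - r\<close> on the unit circle.
\<close>

lemma norm_koornwinder_factor_le:
  assumes "r < 1" "norm a \<le> r" "norm b \<le> r" "norm c \<le> r" "norm d \<le> r" and z: "norm z = 1"
  shows "norm (koornwinder_factor a b c d z) \<le> 2 * (1 / (1 - r)) ^ 6"
proof -
  have *: "norm (inverse (1 - p * w)) \<le> 1 / (1 - r)" if "norm p \<le> r" "norm w = 1" for p w :: complex
    using that assms(1) by (intro norm_inverse_one_minus_le) (auto simp: norm_mult)
  have z': "norm (inverse z) = 1" using z by (simp add: norm_inverse)
  have r: "0 \<le> 1 / (1 - r)" using assms(1) by simp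
  have "norm (1 - z\<^sup>2) \<le> 2"
    using norm_triangle_ineq4[of 1 "z\<^sup>2"] z by (simp add: norm_power)
  then have "norm ((1 - z\<^sup>2) * inverse (1 - a * z) * inverse (1 - b * z) * inverse (1 - c * z) *
      inverse (1 - d * z) * inverse (1 - c * inverse z) * inverse (1 - d * inverse z)) \<le>
      2 * (1 / (1 - r)) * (1 / (1 - r)) * (1 / (1 - r)) * (1 / (1 - r)) * (1 / (1 - r)) * (1 / (1 - r))"
    unfolding norm_mult
    using assms z z' r by (intro mult_mono * mult_nonneg_nonneg norm_ge_zero) auto
  also have "\<dots> = 2 * (1 / (1 - r)) ^ 6"
    by (simp add: eval_nat_numeral)
  finally show ?thesis
    by (simp add: koornwinder_factor_def divide_inverse mult_ac)
qed

lemma norm_cross_factor_le: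
  assumes "r < 1" "norm t \<le> r" and z: "norm z = 1" and w: "norm w = 1"
  shows "norm (cross_factor t z w) \<le> 4 * (1 / (1 - r)) ^ 2"
proof -
  have *: "norm (inverse (1 - t * z * v)) \<le> 1 / (1 - r)" "norm (1 - z * v) \<le> 2"
    if "norm v = 1" for v
    using that assms norm_triangle_ineq4[of 1 "z * v"]
    by (auto intro!: norm_inverse_one_minus_le simp: norm_mult)
  have w': "norm (inverse w) = 1" using w by (simp add: norm_inverse)
  have r: "0 \<le> 1 / (1 - r)" using assms(1) by simp
  have "norm ((1 - z * w) * (1 - z * inverse w) * inverse (1 - t * z * w) *
      inverse (1 - t * z * inverse w)) \<le> 2 * 2 * (1 / (1 - r)) * (1 / (1 - r))"
    unfolding norm_mult[of "_ * _" "inverse _"] norm_mult[of "1 - _" "1 - _"]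
    using w w' r by (intro mult_mono * mult_nonneg_nonneg norm_ge_zero) auto
  then show ?thesis
    by (simp add: cross_factor_def divide_inverse mult_ac power2_eq_square)
qed

text \<open>
  The bound has to be uniform in the parameters, since it serves as the dominating function when \<open>d\<close>
  varies.
\<close>

lemma koornwinder_density_on_bounded:
  assumes "r < 1" "norm t \<le> r" "norm a \<le> r" "norm b \<le> r"
  obtains B where "\<And>c d z. \<lbrakk>norm c \<le> r; norm d \<le> r; \<And>i. i \<in> I \<Longrightarrow> norm (z i) = 1\<rbrakk> \<Longrightarrow>
    norm (koornwinder_density_on I z t a b c d) \<le> B"
proof
  fix c d :: complex and z :: "nat \<Rightarrow> complex"
  assume "norm c \<le> r" "norm d \<le> r" "\<And>i. i \<in> I \<Longrightarrow> norm (z i) = 1"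
  then show "norm (koornwinder_density_on I z t a b c d) \<le>
    (\<Prod>i\<in>I. 2 * (1 / (1 - r)) ^ 6) * (\<Prod>i\<in>I. \<Prod>j\<in>{j\<in>I. i < j}. 4 * (1 / (1 - r)) ^ 2)"
    unfolding koornwinder_density_on_def norm_mult prod_norm[symmetric] using assms
    by (intro mult_mono prod_mono conjI prod_nonneg norm_koornwinder_factor_le
        norm_cross_factor_le norm_ge_zero ballI) auto
qed

lemma integrable_koornwinder_density_on:
  assumes "norm t < 1" "norm a < 1" "norm b < 1" "norm c < 1" "norm d < 1"
  shows "integrable (Pi\<^sub>M I (\<lambda>_. circle_measure)) (\<lambda>z. koornwinder_density_on I z t a b c d)"
proof -
  define r where "r = Max {norm t, norm a, norm b, norm c, norm d}"
  have r: "r < 1" "norm t \<le> r" "norm a \<le> r" "norm b \<le> r" "norm c \<le> r" "norm d \<le> r"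
    using assms unfolding r_def by auto
  obtain B where B: "\<And>c d z. \<lbrakk>norm c \<le> r; norm d \<le> r; \<And>i. i \<in> I \<Longrightarrow> norm (z i) = 1\<rbrakk> \<Longrightarrow>
    norm (koornwinder_density_on I z t a b c d) \<le> B"
    using koornwinder_density_on_bounded[OF r(1-4)] by blast
  interpret P: prob_space "Pi\<^sub>M I (\<lambda>_. circle_measure)"
    by (intro prob_space_PiM prob_space_circle_measure)
  show ?thesis
    by (rule P.integrable_const_bound[where B = B])
      (auto intro!: AE_I2 B borel_measurable_koornwinder_density_on r dest: norm_torus_component)
qed

text \<open>
  Keeping the \<open>s k\<close> in a disc of radius \<open>r < 1\<close> keeps the poles at a positive distance from the
  unit circle, so a constant dominates all the densities.
\<close>

lemma tendsto_integral_koornwinder_density_on: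
  assumes "norm t < 1" "norm a < 1" "norm b < 1" "norm c < 1" "r < 1"
    and s: "\<And>k. norm (s k) \<le> r" and lim: "s \<longlonglongrightarrow> d"
  shows "(\<lambda>k. \<integral>z. koornwinder_density_on I z t a b c (s k) \<partial>Pi\<^sub>M I (\<lambda>_. circle_measure)) \<longlonglongrightarrow>
    (\<integral>z. koornwinder_density_on I z t a b c d \<partial>Pi\<^sub>M I (\<lambda>_. circle_measure))"
proof -
  define R where "R = Max {norm t, norm a, norm b, norm c, r}"
  have R: "R < 1" "norm t \<le> R" "norm a \<le> R" "norm b \<le> R" "norm c \<le> R" "r \<le> R"
    using assms unfolding R_def by auto
  obtain B where B: "\<And>c d z. \<lbrakk>norm c \<le> R; norm d \<le> R; \<And>i. i \<in> I \<Longrightarrow> norm (z i) = 1\<rbrakk> \<Longrightarrow>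
    norm (koornwinder_density_on I z t a b c d) \<le> B"
    using koornwinder_density_on_bounded[OF R(1-4)] by blast
  interpret P: prob_space "Pi\<^sub>M I (\<lambda>_. circle_measure)"
    by (intro prob_space_PiM prob_space_circle_measure)
  have d: "norm d < 1"
    using LIMSEQ_le_const2[OF tendsto_norm[OF lim], of r] s \<open>r < 1\<close> by fastforce
  show ?thesis
  proof (rule integral_dominated_convergence[where w = "\<lambda>_. B"])
    show "AE z in Pi\<^sub>M I (\<lambda>_. circle_measure).
      (\<lambda>k. koornwinder_density_on I z t a b c (s k)) \<longlonglongrightarrow> koornwinder_density_on I z t a b c d"
    proof (rule AE_I2)
      fix z assume "z \<in> space (Pi\<^sub>M I (\<lambda>_. circle_measure))"
      note z = norm_torus_component[OF this]
      have nz: "1 - p * w \<noteq> 0" if "norm p < 1" "norm w = 1" for p w :: complex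
        using that by (intro one_minus_nonzero norm_mult_less_one) auto
      show "(\<lambda>k. koornwinder_density_on I z t a b c (s k)) \<longlonglongrightarrow> koornwinder_density_on I z t a b c d"
        unfolding koornwinder_density_on_def koornwinder_factor_def
        using nz[OF assms(2)] nz[OF assms(3)] nz[OF assms(4)] nz[OF d]
        by (intro tendsto_intros lim) (simp_all add: z norm_inverse del: right_minus_eq)
    qed
    show "AE z in Pi\<^sub>M I (\<lambda>_. circle_measure).
      norm (koornwinder_density_on I z t a b c (s k)) \<le> B" for k
      using R order_trans[OF s R(6)]
      by (auto intro!: AE_I2 B dest: norm_torus_component)
  qed (auto intro: borel_measurable_koornwinder_density_on)
qed

section \<open>The recurrence for the integral\<close>

text \<open>
  Fubini's theorem lets the variable with the least index be integrated first. Each of its two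
  residues multiplies the density in the other variables by a product of cross factors, which is
  absorbed by replacing \<open>c\<close> by \<open>t * c\<close> or \<open>d\<close> by \<open>t * d\<close>. The residue at \<open>d\<close> is treated like the one at \<open>c\<close>
  by means of the symmetry of the density in \<open>c\<close> and \<open>d\<close>.
\<close>

lemma integral_koornwinder_density_on_insert_min:
  assumes "finite I" and less: "\<And>j. j \<in> I \<Longrightarrow> m < j"
    and t: "norm t < 1" and a: "norm a < 1" and b: "norm b < 1"
    and c: "norm c < 1" and d: "norm d < 1" and "c \<noteq> d"
  shows "(\<integral>z. koornwinder_density_on (insert m I) z t a b c d \<partial>Pi\<^sub>M (insert m I) (\<lambda>_. circle_measure)) =
    (c / ((1 - a * c) * (1 - b * c) * (1 - c * d)) *
       (\<integral>z. koornwinder_density_on I z t a b (t * c) d \<partial>Pi\<^sub>M I (\<lambda>_. circle_measure)) -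
     d / ((1 - a * d) * (1 - b * d) * (1 - c * d)) *
       (\<integral>z. koornwinder_density_on I z t a b c (t * d) \<partial>Pi\<^sub>M I (\<lambda>_. circle_measure))) / (c - d)"
    (is "?lhs = ?rhs")
proof -
  let ?P = "\<lambda>I. Pi\<^sub>M I (\<lambda>_::nat. circle_measure)"
  have m: "m \<notin> I" using less by blast
  have tc: "norm (t * c) < 1" and td: "norm (t * d) < 1"
    using t c d by (auto intro: norm_mult_less_one)
  have inner: "(\<integral>y. koornwinder_density_on (insert m I) (x(m := y)) t a b c d \<partial>circle_measure) =
     (c / ((1 - a * c) * (1 - b * c) * (1 - c * d)) * koornwinder_density_on I x t a b (t * c) d -
      d / ((1 - a * d) * (1 - b * d) * (1 - c * d)) * koornwinder_density_on I x t a b c (t * d)) /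
     (c - d)" if "x \<in> space (?P I)" for x
  proof -
    note x = norm_torus_component[OF that]
    have upd: "koornwinder_density_on I (x(m := y)) t a b c d = koornwinder_density_on I x t a b c d"
      "(\<Prod>j\<in>I. cross_factor t y ((x(m := y)) j)) = (\<Prod>j\<in>I. cross_factor t y (x j))" for y
      using m unfolding koornwinder_density_on_def
      by (auto intro!: prod.cong arg_cong2[where f = "(*)"])
    have "(\<integral>y. koornwinder_density_on (insert m I) (x(m := y)) t a b c d \<partial>circle_measure) =
      (\<integral>y. koornwinder_factor a b c d y * (\<Prod>j\<in>I. cross_factor t y (x j)) \<partial>circle_measure) *
      koornwinder_density_on I x t a b c d"
      using koornwinder_density_on_insert_min[OF \<open>finite I\<close> less] upd by simp
    also have "\<dots> = (c / ((1 - a * c) * (1 - b * c) * (1 - c * d)) *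
         ((\<Prod>j\<in>I. cross_factor t c (x j)) * koornwinder_density_on I x t a b c d) -
       d / ((1 - a * d) * (1 - b * d) * (1 - c * d)) *
         ((\<Prod>j\<in>I. cross_factor t d (x j)) * koornwinder_density_on I x t a b d c)) / (c - d)"
      by (subst circle_integral_first_variable[OF t a b c d \<open>c \<noteq> d\<close>])
        (use x in \<open>simp_all add: koornwinder_density_on_commute[of I x t a b d c]
           left_diff_distrib diff_divide_distrib mult.assoc\<close>)
    finally show ?thesis
      using prod_cross_factor_mult_density[of c I x, OF c x] prod_cross_factor_mult_density[of d I x, OF d x]
        koornwinder_density_on_commute[of I x t a b "t * d" c] by simp
  qed
  have "?lhs = (\<integral>x. (\<integral>y. koornwinder_density_on (insert m I) (x(m := y)) t a b c d \<partial>circle_measure) \<partial>?P I)"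
    by (intro torus.product_integral_insert \<open>finite I\<close> m integrable_koornwinder_density_on t a b c d)
  also have "\<dots> = (\<integral>x. (c / ((1 - a * c) * (1 - b * c) * (1 - c * d)) *
        koornwinder_density_on I x t a b (t * c) d -
      d / ((1 - a * d) * (1 - b * d) * (1 - c * d)) * koornwinder_density_on I x t a b c (t * d)) /
     (c - d) \<partial>?P I)"
    by (intro Bochner_Integration.integral_cong refl inner)
  also have "\<dots> = ?rhs"
    using integrable_koornwinder_density_on[OF t a b tc d]
      integrable_koornwinder_density_on[OF t a b c td] by simp
  finally show ?thesis .
qed

section \<open>The recurrence for the closed form\<close>

text \<open>
  The exponents in the second product are \<open>n - 1, \<dots>, 2 * n - 2\<close>. Indexing them by \<open>k < n\<close> makes the
  value 1 for \<open>n = 0\<close>, where the induction starts.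
\<close>

definition koornwinder_value ::
  "nat \<Rightarrow> complex \<Rightarrow> complex \<Rightarrow> complex \<Rightarrow> complex \<Rightarrow> complex \<Rightarrow> complex" where
  "koornwinder_value n t a b c d =
     (\<Prod>i<n. 1 / ((1 - t ^ i * a * c) * (1 - t ^ i * b * c) * (1 - t ^ i * c * d) *
                  (1 - t ^ i * a * d) * (1 - t ^ i * b * d))) *
     (\<Prod>k<n. 1 - t ^ (n - 1 + k) * a * b * c * d)"

lemma koornwinder_value_commute:
  "koornwinder_value n t a b c d = koornwinder_value n t a b d c"
  by (simp add: koornwinder_value_def mult_ac)

text \<open>
  Replacing \<open>c\<close> by \<open>t * c\<close> raises by one every exponent of a factor that contains \<open>c\<close>. In comparison with
  the value for \<open>Suc n\<close>, the first factors with \<open>a * c\<close>, \<open>b * c\<close>, \<open>c * d\<close>, the last ones with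
  \<open>a * d\<close>, \<open>b * d\<close>, and the last factor of the numerator are then missing.
\<close>

lemma koornwinder_value_shift:
  assumes "norm t < 1" "norm a < 1" "norm b < 1" "norm c < 1" "norm d < 1"
  shows "koornwinder_value n t a b (t * c) d * (1 - t ^ n * t ^ n * a * b * c * d) =
    koornwinder_value (Suc n) t a b c d * ((1 - a * c) * (1 - b * c) * (1 - c * d)) *
    ((1 - t ^ n * a * d) * (1 - t ^ n * b * d))"
proof -
  \<comment> \<open>The factors are split according to whether they contain \<open>c\<close>, that is, whether the index shifts.\<close>
  define u where "u i = 1 / ((1 - t ^ i * a * c) * (1 - t ^ i * b * c) * (1 - t ^ i * c * d))" for i
  define v where "v i = 1 / ((1 - t ^ i * a * d) * (1 - t ^ i * b * d))" for i
  have nz: "1 - p * q \<noteq> 0" "1 - t ^ k * p * q \<noteq> 0" if "norm p < 1" "norm q < 1" for p q k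
    using norm_mult_less_one[OF that(1) less_imp_le[OF that(2)]] norm_power_mult_less_one[OF assms(1) norm_mult_less_one[OF that(1) less_imp_le[OF that(2)]]]
    by (auto intro!: one_minus_nonzero simp: mult.assoc simp del: right_minus_eq)
  have num: "(\<Prod>k<n. 1 - t ^ (n - 1 + k) * a * b * (t * c) * d) = (\<Prod>k<n. 1 - t ^ (n + k) * a * b * c * d)"
  proof (rule prod.cong)
    fix k assume "k \<in> {..<n}"
    then have "n + k = Suc (n - 1 + k)" by simp
    then have "t ^ (n + k) = t ^ (n - 1 + k) * t" by (metis power_Suc2)
    then show "1 - t ^ (n - 1 + k) * a * b * (t * c) * d = 1 - t ^ (n + k) * a * b * c * d"
      by (simp add: mult_ac)
  qed simp
  have "koornwinder_value n t a b (t * c) d =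
    (\<Prod>i<n. u (Suc i) * v i) * (\<Prod>k<n. 1 - t ^ (n + k) * a * b * c * d)"
    unfolding koornwinder_value_def num u_def v_def by (simp add: mult_ac)
  then have 1: "koornwinder_value n t a b (t * c) d * (1 - t ^ n * t ^ n * a * b * c * d) =
    (\<Prod>i<n. u (Suc i)) * (\<Prod>i<n. v i) * (\<Prod>k<Suc n. 1 - t ^ (n + k) * a * b * c * d)"
    by (simp add: prod.distrib power_add mult_ac)
  have "koornwinder_value (Suc n) t a b c d =
    (\<Prod>i<Suc n. u i * v i) * (\<Prod>k<Suc n. 1 - t ^ (n + k) * a * b * c * d)"
    unfolding koornwinder_value_def u_def v_def by (simp add: mult_ac)
  also have "(\<Prod>i<Suc n. u i * v i) = (u 0 * (\<Prod>i<n. u (Suc i))) * ((\<Prod>i<n. v i) * v n)"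
    unfolding prod.distrib by (subst prod.lessThan_Suc_shift) simp
  finally have 2: "koornwinder_value (Suc n) t a b c d =
    u 0 * v n * ((\<Prod>i<n. u (Suc i)) * (\<Prod>i<n. v i) * (\<Prod>k<Suc n. 1 - t ^ (n + k) * a * b * c * d))"
    by (simp only: mult_ac)
  have "u 0 * ((1 - a * c) * (1 - b * c) * (1 - c * d)) = 1"
    "v n * ((1 - t ^ n * a * d) * (1 - t ^ n * b * d)) = 1"
    using assms nz by (simp_all add: u_def v_def del: right_minus_eq)
  moreover have "p * q * w * A * B = (p * A) * (q * B) * w" for p q w A B :: complex
    by (simp only: mult_ac)
  ultimately show ?thesis
    unfolding 1 2 by (simp only: mult_1)
qed

text \<open>
  Both values on the right are, by the previous lemma, explicit multiples of the value on the left,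
  and what remains is a polynomial identity in \<open>T = t ^ n\<close>: the terms linear in \<open>T\<close> cancel, and the
  others have \<open>c - d\<close> as a common factor.
\<close>

lemma koornwinder_value_recurrence:
  assumes "norm t < 1" "norm a < 1" "norm b < 1" "norm c < 1" "norm d < 1" "c \<noteq> d"
  shows "koornwinder_value (Suc n) t a b c d =
    (c / ((1 - a * c) * (1 - b * c) * (1 - c * d)) * koornwinder_value n t a b (t * c) d -
     d / ((1 - a * d) * (1 - b * d) * (1 - c * d)) * koornwinder_value n t a b c (t * d)) / (c - d)"
proof -
  define V where "V = koornwinder_value (Suc n) t a b c d"
  define T where "T = t ^ n"
  define A where "A = (1 - a * c) * (1 - b * c) * (1 - c * d)"
  define B where "B = (1 - a * d) * (1 - b * d) * (1 - c * d)"
  define D where "D = 1 - T * T * a * b * c * d"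
  define X where "X = koornwinder_value n t a b (t * c) d"
  define Y where "Y = koornwinder_value n t a b c (t * d)"
  have nz: "1 - p * q \<noteq> 0" if "norm p < 1" "norm q < 1" for p q :: complex
    using norm_mult_less_one[OF that(1) less_imp_le[OF that(2)]] by (rule one_minus_nonzero)
  have "A \<noteq> 0" "B \<noteq> 0"
    using assms nz unfolding A_def B_def by (simp_all del: right_minus_eq)
  have "norm (t ^ n * (t ^ n * (a * b * c * d))) < 1"
    using assms by (intro norm_power_mult_less_one norm_mult_less_one) auto
  then have "D \<noteq> 0"
    unfolding D_def T_def using one_minus_nonzero by (simp add: mult.assoc del: right_minus_eq)
  have "X * D = V * A * ((1 - T * a * d) * (1 - T * b * d))"
    unfolding X_def D_def V_def A_def T_def by (rule koornwinder_value_shift[OF assms(1-5)])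
  then have X: "X / A = V * ((1 - T * a * d) * (1 - T * b * d)) / D"
    using \<open>A \<noteq> 0\<close> \<open>D \<noteq> 0\<close> by (simp add: field_simps)
  have "Y * D = V * B * ((1 - T * a * c) * (1 - T * b * c))"
    using koornwinder_value_shift[OF assms(1-3,5,4), of n]
    unfolding Y_def D_def V_def B_def T_def
      koornwinder_value_commute[of n t a b c "t * d"] koornwinder_value_commute[of "Suc n" t a b c d]
    by (simp only: mult_ac)
  then have Y: "Y / B = V * ((1 - T * a * c) * (1 - T * b * c)) / D"
    using \<open>B \<noteq> 0\<close> \<open>D \<noteq> 0\<close> by (simp add: field_simps)
  have "c * ((1 - T * a * d) * (1 - T * b * d)) - d * ((1 - T * a * c) * (1 - T * b * c)) = (c - d) * D"
    unfolding D_def by (simp add: algebra_simps)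
  moreover have "c * (V * P / D) - d * (V * Q / D) = V * (c * P - d * Q) / D" for P Q
    by (simp add: right_diff_distrib diff_divide_distrib mult_ac)
  ultimately have "c * (X / A) - d * (Y / B) = V * ((c - d) * D) / D"
    unfolding X Y by simp
  then have "V = (c * (X / A) - d * (Y / B)) / (c - d)"
    using \<open>D \<noteq> 0\<close> \<open>c \<noteq> d\<close> by simp
  then show ?thesis
    unfolding V_def X_def Y_def A_def B_def by simp
qed

lemma tendsto_koornwinder_value:
  assumes "norm t < 1" "norm a < 1" "norm b < 1" "norm c < 1" "norm d < 1" and lim: "s \<longlonglongrightarrow> d"
  shows "(\<lambda>k. koornwinder_value n t a b c (s k)) \<longlonglongrightarrow> koornwinder_value n t a b c d"
proof -
  have nz: "1 - t ^ k * p * q \<noteq> 0" if "norm p < 1" "norm q < 1" for p q k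
    using norm_power_mult_less_one[OF assms(1) norm_mult_less_one[OF that(1) less_imp_le[OF that(2)]]]
    by (auto intro!: one_minus_nonzero simp: mult.assoc simp del: right_minus_eq)
  show ?thesis
    unfolding koornwinder_value_def
    using assms nz by (intro tendsto_intros lim) (simp_all del: right_minus_eq)
qed

section \<open>Evaluation of the integral\<close>

text \<open>
  Adding a new least index at each step of the induction matches the order of integration, in which
  the least index comes first.
\<close>

lemma integral_koornwinder_density_on:
  assumes "finite I" "norm t < 1" "norm a < 1" "norm b < 1" "norm c < 1" "norm d < 1"
  shows "(\<integral>z. koornwinder_density_on I z t a b c d \<partial>Pi\<^sub>M I (\<lambda>_. circle_measure)) =
    koornwinder_value (card I) t a b c d"
  using assms
proof (induction I arbitrary: c d rule: finite_linorder_min_induct)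
  case empty
  interpret P: prob_space "Pi\<^sub>M {} (\<lambda>_::nat. circle_measure)"
    by (intro prob_space_PiM prob_space_circle_measure)
  show ?case
    by (simp add: koornwinder_density_on_def koornwinder_value_def P.prob_space)
next
  case (insert m I)
  let ?J = "\<lambda>c d. \<integral>z. koornwinder_density_on (insert m I) z t a b c d \<partial>Pi\<^sub>M (insert m I) (\<lambda>_. circle_measure)"
  have "m \<notin> I" using insert.hyps by blast
  then have card: "card (insert m I) = Suc (card I)"
    using insert.hyps by simp
  have distinct: "?J c d = koornwinder_value (card (insert m I)) t a b c d"
    if "norm c < 1" "norm d < 1" "c \<noteq> d" for c d
  proof -
    have "norm (t * c) < 1" "norm (t * d) < 1"
      using insert.prems that by (auto intro: norm_mult_less_one)
    then show ?thesis
      using insert.hyps insert.prems that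
      by (simp add: card koornwinder_value_recurrence integral_koornwinder_density_on_insert_min insert.IH)
  qed
  show ?case
  proof (cases "c = d")
    case False
    then show ?thesis using insert.prems distinct by blast
  next
    case True
    \<comment> \<open>Approach \<open>d = c\<close> by parameters \<open>s k\<close> that differ from \<open>c\<close> and stay in the disc of radius
      \<open>norm c + e < 1\<close>, half way from \<open>norm c\<close> to 1.\<close>
    define e where "e = (1 - norm c) / 2"
    define s where "s k = c + of_real (e / real (Suc k))" for k
    have e: "e > 0" using insert.prems by (simp add: e_def)
    have s: "norm (s k) \<le> norm c + e" "s k \<noteq> c" for k
    proof -
      have "norm (s k) \<le> norm c + norm (of_real (e / real (Suc k)) :: complex)"
        unfolding s_def by (rule norm_triangle_ineq)
      also have "norm (of_real (e / real (Suc k)) :: complex) = e / real (Suc k)"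
        using e unfolding norm_of_real by simp
      also have "\<dots> \<le> e"
        using e by (simp add: field_simps)
      finally show "norm (s k) \<le> norm c + e" by simp
      show "s k \<noteq> c"
        unfolding s_def using e by (simp del: of_nat_Suc of_real_divide)
    qed
    have less: "norm c + e < 1"
      using insert.prems by (simp add: e_def field_simps)
    have "(\<lambda>k. e / real (Suc k)) \<longlonglongrightarrow> 0"
      using tendsto_mult_right_zero[OF LIMSEQ_inverse_real_of_nat, of e] by (simp add: divide_inverse)
    then have "s \<longlonglongrightarrow> c + of_real 0"
      unfolding s_def by (intro tendsto_intros)
    then have lim: "s \<longlonglongrightarrow> d" using True by simp
    have "(\<lambda>k. ?J c (s k)) \<longlonglongrightarrow> ?J c d"
      using insert.prems s less lim by (intro tendsto_integral_koornwinder_density_on)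
    moreover have "?J c (s k) = koornwinder_value (card (insert m I)) t a b c (s k)" for k
      using insert.prems s[of k] less by (intro distinct) auto
    ultimately have "(\<lambda>k. koornwinder_value (card (insert m I)) t a b c (s k)) \<longlonglongrightarrow> ?J c d"
      by simp
    moreover have "(\<lambda>k. koornwinder_value (card (insert m I)) t a b c (s k)) \<longlonglongrightarrow>
      koornwinder_value (card (insert m I)) t a b c d"
      using insert.prems lim by (intro tendsto_koornwinder_value)
    ultimately show ?thesis by (rule LIMSEQ_unique)
  qed
qed

theorem theorem3p4:
  fixes n :: nat and t a b c d :: complex
  assumes "n \<ge> 1"
    and "norm t < 1" and "norm a < 1" and "norm b < 1" and "norm c < 1" and "norm d < 1"
  shows "(\<integral>z. koornwinder_density n z t a b c d \<partial>torus_measure n) =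
    (\<Prod>i=0..n - 1. 1 / ((1 - t ^ i * a * c) * (1 - t ^ i * b * c) * (1 - t ^ i * c * d) *
                        (1 - t ^ i * a * d) * (1 - t ^ i * b * d))) *
    (\<Prod>j=n - 1..2 * n - 2. 1 - t ^ j * a * b * c * d)"
proof -
  have "{0..n - 1} = {..<n}" using \<open>n \<ge> 1\<close> by auto
  moreover have "(\<Prod>j=n - 1..2 * n - 2. 1 - t ^ j * a * b * c * d) =
      (\<Prod>k<n. 1 - t ^ (n - 1 + k) * a * b * c * d)"
    using \<open>n \<ge> 1\<close>
    by (intro prod.reindex_bij_witness[where i = "\<lambda>k. n - 1 + k" and j = "\<lambda>j. j - (n - 1)"]) auto
  ultimately show ?thesis
    using integral_koornwinder_density_on[of "{1..n}" t a b c d] assms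
    by (simp add: koornwinder_density_eq_on torus_measure_def koornwinder_value_def)
qed

end
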